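(* Let $G=(V,A)$ be a finite digraph with event periods $\boldsymbol{T}=(T_i)_{i\in V}\in\mathbb{N}^V$. A vector $x\in\mathbb{R}^A$ satisfies the $\boldsymbol{T}$-cycle periodicity property, i.e., $$\sum_{a\in C^+}x_a-\sum_{a\in C^-}x_a\equiv 0 \bmod T_C\quad\text{for all cycles } C \text{ in } G,$$ if and only if there is a vector $\pi\in\mathbb{R}^V$ such that $\pi_j-\pi_i\equiv x_a \bmod T_a$ for all $a=(i,j)\in A$.
   Context: $\mathbb{N}$ denotes the positive integers. For real numbers, $s\equiv t\bmod m$ means $s-t\in m\mathbb{Z}$. For an arc $a=(i,j)\in A$, $T_a:=\gcd\{T_i,T_j\}$. Cycles are understood in the underlying undirected graph, i.e., arcs may be used against their orientation (loops and pairs of parallel or antiparallel arcs count as cycles). After fixing a direction of traversal of a cycle $C$, $C^+$ and $C^-$ denote its forward and backward arcs, and $T_C:=\gcd\{T_a\mid a\in C\}$. *)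

theory Defs
  imports "Graph_Theory.Graph_Theory" "HOL-Library.Real_Mod"
begin

lemma rcong_iff_diff_int_multiple: "[s = t] (rmod m) \<longleftrightarrow> (\<exists>k::int. s - t = m * of_int k)"
proof -
  have "[s = t] (rmod m) \<longleftrightarrow> [t = s] (rmod m)"
    by (rule rcong_sym_iff)
  also have "\<dots> \<longleftrightarrow> (\<exists>k. s = t + of_int k * m)"
    by (rule rcong_altdef)
  also have "\<dots> \<longleftrightarrow> (\<exists>k::int. s - t = m * of_int k)"
    by (simp add: algebra_simps)
  finally show ?thesis .
qed

text \<open>
  The underlying undirected multigraph: the element \<open>(a, True)\<close> is the arc \<open>a\<close> traversed along
  its orientation, \<open>(a, False)\<close> is \<open>a\<close> traversed against it. Keeping the identity of \<open>a\<close> (unlike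
  \<^const>\<open>mk_symmetric\<close>) retains parallel arcs.
\<close>

definition underlying :: "('a, 'b) pre_digraph \<Rightarrow> ('a, 'b \<times> bool) pre_digraph" where
  "underlying G =
     \<lparr>verts = verts G,
      arcs = arcs G \<times> UNIV,
      tail = (\<lambda>(a, fwd). if fwd then tail G a else head G a),
      head = (\<lambda>(a, fwd). if fwd then head G a else tail G a)\<rparr>"

text \<open>
  A cycle together with a direction of traversal. Distinctness of the arcs only rules out walking
  along a single non-loop arc and straight back; otherwise it follows from
  \<^const>\<open>pre_digraph.cycle\<close>.
\<close>

definition oriented_cycle :: "('a, 'b) pre_digraph \<Rightarrow> ('b \<times> bool) list \<Rightarrow> bool" where
  "oriented_cycle G C \<longleftrightarrow> pre_digraph.cycle (underlying G) C \<and> distinct (map fst C)"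

definition forward_arcs :: "('b \<times> bool) list \<Rightarrow> 'b set" where
  "forward_arcs C = {a. (a, True) \<in> set C}"

definition backward_arcs :: "('b \<times> bool) list \<Rightarrow> 'b set" where
  "backward_arcs C = {a. (a, False) \<in> set C}"

definition arc_period :: "('a, 'b) pre_digraph \<Rightarrow> ('a \<Rightarrow> nat) \<Rightarrow> 'b \<Rightarrow> nat" where
  "arc_period G T a = gcd (T (tail G a)) (T (head G a))"

definition cycle_period :: "('a, 'b) pre_digraph \<Rightarrow> ('a \<Rightarrow> nat) \<Rightarrow> ('b \<times> bool) list \<Rightarrow> nat" where
  "cycle_period G T C = Gcd (arc_period G T ` fst ` set C)"

definition cycle_periodicity ::
    "('a, 'b) pre_digraph \<Rightarrow> ('a \<Rightarrow> nat) \<Rightarrow> ('b \<Rightarrow> real) \<Rightarrow> bool" where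
  "cycle_periodicity G T x \<longleftrightarrow>
     (\<forall>C. oriented_cycle G C \<longrightarrow>
        [(\<Sum>a\<in>forward_arcs C. x a) - (\<Sum>a\<in>backward_arcs C. x a) = 0]
          (rmod (real (cycle_period G T C))))"

end

theory Submission
  imports Defs "HOL-Number_Theory.Cong"
begin

text \<open>
  Sufficiency is a local-to-global argument. If the arc moduli are powers of one fixed prime, a
  potential is built by inserting the arcs in order of decreasing exponent, as in Kruskal's
  algorithm: a new arc joining two components is accommodated by shifting the potential on one of
  them, and a new arc inside a component closes a cycle on which its own modulus divides all others.
  The potential for modulus 1 makes the problem integral: each prime-power potential differs from
  it by a function whose floor has the same differences along arcs. These integral corrections
  are combined by the Chinese remainder theorem at every node \<open>i\<close> modulo \<open>T i\<close>.
\<close>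

section \<open>Congruences of reals modulo natural numbers\<close>

lemma rcong_dvd_modulus:
  assumes "[s = t] (rmod (real m))" "n dvd m"
  shows "[s = t] (rmod (real n))"
proof -
  obtain k where k: "s - t = real m * of_int k"
    using assms(1) unfolding rcong_iff_diff_int_multiple by blast
  obtain l where "m = n * l" using assms(2) by blast
  then have "s - t = real n * of_int (int l * k)" using k by simp
  then show ?thesis unfolding rcong_iff_diff_int_multiple by blast
qed

lemma rcong_of_int_iff: "[of_int i = of_int j] (rmod (real n)) \<longleftrightarrow> int n dvd i - j"
proof -
  have "real_of_int i - of_int j = real n * of_int k \<longleftrightarrow> i - j = int n * k" for k
    by (metis of_int_diff of_int_eq_iff of_int_mult of_int_of_nat_eq)
  then show ?thesis unfolding rcong_iff_diff_int_multiple dvd_def by blast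
qed

lemma rcong_1_iff: "[s = t] (rmod 1) \<longleftrightarrow> s - t \<in> \<int>"
  unfolding rcong_iff_diff_int_multiple by (auto elim: Ints_cases)

section \<open>Signed sums along walks\<close>

definition walk_sum :: "('b \<Rightarrow> real) \<Rightarrow> ('b \<times> bool) list \<Rightarrow> real" where
  "walk_sum x C = (\<Sum>(a, fwd)\<leftarrow>C. if fwd then x a else - x a)"

lemma walk_sum_simps [simp]:
  "walk_sum x [] = 0"
  "walk_sum x ((a, fwd) # C) = (if fwd then x a else - x a) + walk_sum x C"
  by (simp_all add: walk_sum_def)

lemma finite_forward_backward_arcs [simp]: "finite (forward_arcs C)" "finite (backward_arcs C)"
  by (rule finite_subset[of _ "fst ` set C"]; force simp: forward_arcs_def backward_arcs_def)+

text \<open>With distinct arcs, each arc of \<open>C\<close> is traversed once and in one direction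
  only, so passing to sets loses no multiplicity.\<close>

lemma walk_sum_conv_sum:
  assumes "distinct (map fst C)"
  shows "walk_sum x C = (\<Sum>a\<in>forward_arcs C. x a) - (\<Sum>a\<in>backward_arcs C. x a)"
  using assms
proof (induction C)
  case Nil
  then show ?case by (simp add: forward_arcs_def backward_arcs_def)
next
  case (Cons c C)
  obtain a fwd where c: "c = (a, fwd)" by (cases c)
  have a: "a \<notin> forward_arcs C" "a \<notin> backward_arcs C"
    using Cons.prems by (force simp: c forward_arcs_def backward_arcs_def)+
  have F: "forward_arcs (c # C) = (if fwd then insert a (forward_arcs C) else forward_arcs C)"
    and B: "backward_arcs (c # C) = (if fwd then backward_arcs C else insert a (backward_arcs C))"
    by (auto simp: c forward_arcs_def backward_arcs_def)
  show ?case using Cons a by (simp add: F B) (simp add: c)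
qed

section \<open>Walks in the underlying undirected multigraph\<close>

lemma underlying_simps [simp]:
  "verts (underlying G) = verts G"
  "arcs (underlying G) = arcs G \<times> UNIV"
  "tail (underlying G) (a, fwd) = (if fwd then tail G a else head G a)"
  "head (underlying G) (a, fwd) = (if fwd then head G a else tail G a)"
  by (simp_all add: underlying_def)

lemma wf_digraph_underlying:
  assumes "wf_digraph G"
  shows "wf_digraph (underlying G)"
proof -
  interpret wf_digraph G by fact
  show ?thesis by unfold_locales auto
qed

lemma tail_head_underlying_arcs_update:
  "tail (underlying (G\<lparr>arcs := S\<rparr>)) = tail (underlying G)"
  "head (underlying (G\<lparr>arcs := S\<rparr>)) = head (underlying G)"
  by (simp_all add: underlying_def fun_eq_iff)

text \<open>\<open>cas\<close> consults only tails and heads, never the arc set. This lets a path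
  found among the arcs of \<open>S\<close> be reused in \<open>G\<close>.\<close>

lemma cas_underlying_arcs_update:
  "pre_digraph.cas (underlying (G\<lparr>arcs := S\<rparr>)) u p v \<longleftrightarrow> pre_digraph.cas (underlying G) u p v"
  by (induction p arbitrary: u) (simp_all add: pre_digraph.cas.simps tail_head_underlying_arcs_update)

lemma awalk_verts_underlying_arcs_update:
  "pre_digraph.awalk_verts (underlying (G\<lparr>arcs := S\<rparr>)) u p = pre_digraph.awalk_verts (underlying G) u p"
  by (induction p arbitrary: u)
    (simp_all add: pre_digraph.awalk_verts.simps tail_head_underlying_arcs_update)

text \<open>The potential differences telescope along the walk; an arc traversed backwards
  contributes the negated congruence.\<close>

lemma rcong_potential_walk_sum:
  assumes "pre_digraph.cas (underlying G) u p v"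
    and "\<And>a. a \<in> fst ` set p \<Longrightarrow> [\<pi> (head G a) - \<pi> (tail G a) = x a] (rmod m)"
  shows "[\<pi> v - \<pi> u = walk_sum x p] (rmod m)"
  using assms
proof (induction p arbitrary: u)
  case Nil
  then show ?case by (simp add: pre_digraph.cas.simps)
next
  case (Cons c p)
  obtain a fwd where c: "c = (a, fwd)" by (cases c)
  define w where "w = head (underlying G) c"
  have "pre_digraph.cas (underlying G) w p v" and u: "tail (underlying G) c = u"
    using Cons.prems(1) by (simp_all add: pre_digraph.cas.simps w_def)
  then have IH: "[\<pi> v - \<pi> w = walk_sum x p] (rmod m)"
    using Cons.IH Cons.prems(2) by simp
  have a: "[\<pi> (head G a) - \<pi> (tail G a) = x a] (rmod m)"
    using Cons.prems(2) by (simp add: c)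
  have "[\<pi> w - \<pi> u = (if fwd then x a else - x a)] (rmod m)"
    using a rcong_uminus[OF a] u by (auto simp: c w_def)
  from rcong_add[OF this IH] show ?case by (simp add: c)
qed

text \<open>If the first arc occurred again, in either direction, both of its ends would be visited
  later, including the start vertex \<open>u\<close>, which a path never revisits.\<close>

lemma distinct_fst_apath_underlying:
  assumes "wf_digraph G" "pre_digraph.apath (underlying G) u p v"
  shows "distinct (map fst p)"
  using assms(2)
proof (induction p arbitrary: u)
  case Nil
  then show ?case by simp
next
  case (Cons c p)
  interpret U: wf_digraph "underlying G" by (rule wf_digraph_underlying[OF assms(1)])
  obtain a fwd where c: "c = (a, fwd)" by (cases c)
  let ?w = "head (underlying G) c"
  have p: "U.apath ?w p v" and u: "u \<notin> set (U.awalk_verts ?w p)" "tail (underlying G) c = u"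
    using Cons.prems by (auto simp: U.apath_Cons_iff)
  have "a \<notin> fst ` set p"
  proof
    assume "a \<in> fst ` set p"
    then obtain fwd' where e: "(a, fwd') \<in> set p" by auto
    have w: "U.awalk ?w p v" using p by (simp add: U.apath_def)
    have "tail (underlying G) (a, fwd') \<in> set (U.awalk_verts ?w p)"
      "head (underlying G) (a, fwd') \<in> set (U.awalk_verts ?w p)"
      using U.awalk_verts_arc1[OF e] U.awalk_verts_arc2[OF w e] by auto
    then show False using u by (cases fwd; cases fwd') (auto simp: c)
  qed
  then show ?case using Cons.IH[OF p] by (simp add: c)
qed

section \<open>Potentials for powers of one base\<close>

text \<open>Powers of one base form a chain under divisibility, so a lower bound \<open>l\<close> on
  the exponents can replace the gcd over the cycle.\<close>

lemma prime_power_potential_exists: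
  fixes q :: nat and k :: "'b \<Rightarrow> nat"
  assumes "wf_digraph G" "finite S" "S \<subseteq> arcs G"
    and cycles: "\<And>C l. oriented_cycle G C \<Longrightarrow> (\<And>a. a \<in> fst ` set C \<Longrightarrow> l \<le> k a) \<Longrightarrow>
      [walk_sum x C = 0] (rmod (real (q ^ l)))"
  shows "\<exists>\<pi>. \<forall>a\<in>S. [\<pi> (head G a) - \<pi> (tail G a) = x a] (rmod (real (q ^ k a)))"
  using assms(2,3)
\<comment> \<open>Negation puts the largest exponents first: \<open>k a\<close> is at most every
  exponent already in \<open>S\<close>.\<close>
proof (induction rule: finite_ranking_induct[where f = "\<lambda>a. - int (k a)"])
  case empty
  then show ?case by simp
next
  case (insert a S)
  interpret wf_digraph G by fact
  obtain \<pi> where \<pi>: "\<And>b. b \<in> S \<Longrightarrow> [\<pi> (head G b) - \<pi> (tail G b) = x b] (rmod (real (q ^ k b)))"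
    using insert by auto
  show ?case
  \<comment> \<open>The ranking induction may insert an element that is already present.\<close>
  proof (cases "a \<in> S")
    case True
    then show ?thesis using \<pi> by (auto simp: insert_absorb)
  next
    case aS: False
    let ?H = "underlying (G\<lparr>arcs := S\<rparr>)"
    have wfH: "wf_digraph (G\<lparr>arcs := S\<rparr>)"
      using insert.prems by unfold_locales auto
    interpret H: wf_digraph ?H by (rule wf_digraph_underlying[OF wfH])
    interpret U: wf_digraph "underlying G" by (rule wf_digraph_underlying) fact
    have aG: "a \<in> arcs G" using insert.prems by simp
    show ?thesis
    proof (cases "head G a \<rightarrow>\<^sup>*\<^bsub>?H\<^esub> tail G a")
      case True
      then obtain p where p: "H.apath (head G a) p (tail G a)"
        by (auto simp: H.reachable_apath)
      then have pS: "fst ` set p \<subseteq> S" and cas: "U.cas (head G a) p (tail G a)"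
        and dist: "distinct (U.awalk_verts (head G a) p)"
        by (auto simp: H.apath_def H.awalk_def cas_underlying_arcs_update
            awalk_verts_underlying_arcs_update)
      \<comment> \<open>Following \<open>a\<close> by a path from its head back to its tail closes a
        cycle; if \<open>a\<close> is a loop, the path is empty.\<close>
      define C where "C = (a, True) # p"
      have "U.awalk (tail G a) C (tail G a)"
        using cas pS insert.prems aG by (force simp: U.awalk_def C_def)
      then have "U.cycle C"
        unfolding U.cycle_def using dist by (auto simp: C_def)
      moreover have "distinct (map fst C)"
        using distinct_fst_apath_underlying[OF wfH p] pS aS by (auto simp: C_def)
      ultimately have "oriented_cycle G C" by (simp add: oriented_cycle_def)
      moreover have le: "k a \<le> k b" if "b \<in> S" for b using insert.hyps(2)[OF that] by simp
      ultimately have C0: "[walk_sum x C = 0] (rmod (real (q ^ k a)))"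
        using pS by (intro cycles) (auto simp: C_def)
      have "[\<pi> (head G b) - \<pi> (tail G b) = x b] (rmod (real (q ^ k a)))" if "b \<in> S" for b
        using \<pi>[OF that] le[OF that] by (rule rcong_dvd_modulus[OF _ le_imp_power_dvd])
      then have "[\<pi> (tail G a) - \<pi> (head G a) = walk_sum x p] (rmod (real (q ^ k a)))"
        using pS by (intro rcong_potential_walk_sum[OF cas]) blast
      from rcong_diff[OF C0 rcong_sym[OF this]]
      have "[x a = \<pi> (head G a) - \<pi> (tail G a)] (rmod (real (q ^ k a)))"
        by (simp add: C_def)
      from rcong_sym[OF this] show ?thesis using \<pi> by auto
    next
      case False
      \<comment> \<open>\<open>R\<close> is the component of the head of \<open>a\<close> among the
        inserted arcs. Shifting the potential on \<open>R\<close> by the defect \<open>c\<close>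
        makes the difference along \<open>a\<close> exactly \<open>x a\<close>.\<close>
      define R where "R = {v. head G a \<rightarrow>\<^sup>*\<^bsub>?H\<^esub> v}"
      define c where "c = x a - (\<pi> (head G a) - \<pi> (tail G a))"
      define \<pi>' where "\<pi>' v = (if v \<in> R then \<pi> v + c else \<pi> v)" for v
      have "head G a \<in> R" using aG by (auto simp: R_def)
      moreover have "tail G a \<notin> R" using False by (simp add: R_def)
      ultimately have "\<pi>' (head G a) - \<pi>' (tail G a) = x a" by (simp add: \<pi>'_def c_def)
      moreover have "\<pi>' (head G b) - \<pi>' (tail G b) = \<pi> (head G b) - \<pi> (tail G b)" if "b \<in> S" for b
      proof -
        \<comment> \<open>Both orientations of \<open>b\<close> are present, so no arc of
          \<open>S\<close> leaves or enters \<open>R\<close>.\<close>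
        have "(tail G b, head G b) \<in> arcs_ends ?H" "(head G b, tail G b) \<in> arcs_ends ?H"
          using that by (force simp: arcs_ends_def arc_to_ends_def)+
        then have "head G b \<in> R \<longleftrightarrow> tail G b \<in> R"
          unfolding R_def by (auto intro: H.reachable_adj_trans)
        then show ?thesis by (simp add: \<pi>'_def)
      qed
      ultimately show ?thesis using \<pi> by (intro exI[of _ \<pi>']) auto
    qed
  qed
qed

section \<open>Gluing by the Chinese remainder theorem\<close>

text \<open>Only the finitely many prime factors of \<open>n\<close> impose a condition; for any
  other prime the modulus is 1.\<close>

lemma chinese_remainder_prime_powers:
  fixes n :: nat and u :: "nat \<Rightarrow> int"
  assumes "n > 0"
  shows "\<exists>r. \<forall>p. prime p \<longrightarrow> int (p ^ multiplicity p n) dvd r - u p"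
proof -
  define m where "m p = p ^ multiplicity p n" for p
  have "\<exists>y. \<forall>p\<in>prime_factors n. [y = nat (u p mod int (m p))] (mod m p)"
    by (rule chinese_remainder_nat) (auto simp: m_def intro!: primes_coprime coprime_power_left_iff)
  then obtain y where y: "\<And>p. p \<in> prime_factors n \<Longrightarrow> [y = nat (u p mod int (m p))] (mod m p)"
    by blast
  have "int (m p) dvd int y - u p" if "prime p" for p
  proof (cases "p \<in> prime_factors n")
    case True
    have "m p > 0" using that by (simp add: m_def prime_gt_0_nat)
    then have "[int y = u p mod int (m p)] (mod int (m p))"
      using y[OF True] by (simp flip: cong_int_iff)
    then show ?thesis by (simp add: cong_iff_dvd_diff[symmetric])
  next
    case False
    then show ?thesis using that assms
      by (simp add: m_def in_prime_factors_iff not_dvd_imp_multiplicity_0)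
  qed
  then show ?thesis by (auto simp: m_def)
qed

theorem theorem12:
  fixes G :: "('a, 'b) pre_digraph" and T :: "'a \<Rightarrow> nat" and x :: "'b \<Rightarrow> real"
  assumes "fin_digraph G"
    and "\<And>i. i \<in> verts G \<Longrightarrow> T i > 0"
  shows "cycle_periodicity G T x \<longleftrightarrow>
    (\<exists>\<pi> :: 'a \<Rightarrow> real. \<forall>a\<in>arcs G.
       [\<pi> (head G a) - \<pi> (tail G a) = x a] (rmod (real (arc_period G T a))))"
proof
  assume "\<exists>\<pi> :: 'a \<Rightarrow> real. \<forall>a\<in>arcs G.
       [\<pi> (head G a) - \<pi> (tail G a) = x a] (rmod (real (arc_period G T a)))"
  then obtain \<pi> where \<pi>: "\<And>a. a \<in> arcs G \<Longrightarrow>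
      [\<pi> (head G a) - \<pi> (tail G a) = x a] (rmod (real (arc_period G T a)))" by blast
  show "cycle_periodicity G T x"
    unfolding cycle_periodicity_def
  proof (intro allI impI)
    fix C assume C: "oriented_cycle G C"
    then obtain u where u: "pre_digraph.cas (underlying G) u C u" and "set C \<subseteq> arcs G \<times> UNIV"
      by (auto simp: oriented_cycle_def pre_digraph.cycle_def pre_digraph.awalk_def)
    \<comment> \<open>The cycle period divides every arc period on \<open>C\<close>, so the arc
      congruences telescope modulo it.\<close>
    then have "[\<pi> u - \<pi> u = walk_sum x C] (rmod (real (cycle_period G T C)))"
      by (intro rcong_potential_walk_sum[OF u] rcong_dvd_modulus[OF \<pi>])
        (auto simp: cycle_period_def intro: Gcd_dvd)
    moreover have "distinct (map fst C)" using C by (simp add: oriented_cycle_def)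
    ultimately show "[(\<Sum>a\<in>forward_arcs C. x a) - (\<Sum>a\<in>backward_arcs C. x a) = 0]
        (rmod (real (cycle_period G T C)))"
      by (subst rcong_sym_iff) (simp add: walk_sum_conv_sum)
  qed
next
  assume per: "cycle_periodicity G T x"
  interpret fin_digraph G by fact
  define d where "d \<pi> a = \<pi> (head G a) - \<pi> (tail G a)" for \<pi> :: "'a \<Rightarrow> real" and a
  have potential: "\<exists>\<pi>. \<forall>a\<in>arcs G. [d \<pi> a = x a] (rmod (real (q ^ k a)))"
    if dvd: "\<And>a. a \<in> arcs G \<Longrightarrow> q ^ k a dvd arc_period G T a" for q and k :: "'b \<Rightarrow> nat"
    unfolding d_def
  proof (rule prime_power_potential_exists)
    fix C l assume C: "oriented_cycle G C" and l: "\<And>a. a \<in> fst ` set C \<Longrightarrow> l \<le> k a"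
    have "set C \<subseteq> arcs G \<times> UNIV"
      using C by (auto simp: oriented_cycle_def pre_digraph.cycle_def pre_digraph.awalk_def)
    then have "q ^ l dvd arc_period G T a" if "a \<in> fst ` set C" for a
      using that by (intro dvd_trans[OF le_imp_power_dvd[OF l] dvd]) auto
    \<comment> \<open>A common divisor of the arc periods on \<open>C\<close> divides their
      gcd.\<close>
    then have "q ^ l dvd cycle_period G T C"
      unfolding cycle_period_def by (intro Gcd_greatest) blast
    moreover have "[walk_sum x C = 0] (rmod (real (cycle_period G T C)))"
      using per C by (simp add: cycle_periodicity_def oriented_cycle_def walk_sum_conv_sum)
    ultimately show "[walk_sum x C = 0] (rmod (real (q ^ l)))"
      by (rule rcong_dvd_modulus[rotated])
  qed (auto intro: wf_digraph)
  \<comment> \<open>The base 1 turns every modulus into 1.\<close>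
  have "\<exists>\<pi>. \<forall>a\<in>arcs G. [d \<pi> a = x a] (rmod 1)"
    using potential[of 1 "\<lambda>_. 0"] by simp
  then obtain \<pi>0 where \<pi>0: "\<And>a. a \<in> arcs G \<Longrightarrow> d \<pi>0 a - x a \<in> \<int>"
    unfolding rcong_1_iff by blast
  have "\<exists>\<pi>. \<forall>a\<in>arcs G. [d \<pi> a = x a] (rmod (real (p ^ multiplicity p (arc_period G T a))))" for p
    by (rule potential) (rule multiplicity_dvd)
  then obtain P where P: "\<And>p a. a \<in> arcs G \<Longrightarrow>
      [d (P p) a = x a] (rmod (real (p ^ multiplicity p (arc_period G T a))))"
    by metis
  \<comment> \<open>\<open>P p - \<pi>0\<close> need not be integral, but along each arc it changes
    by an integer, and so its floor changes by the same integer.\<close>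
  define \<rho> where "\<rho> p i = \<lfloor>P p i - \<pi>0 i\<rfloor>" for p i
  have \<rho>: "of_int (\<rho> p (head G a) - \<rho> p (tail G a)) = d (P p) a - d \<pi>0 a" if a: "a \<in> arcs G" for p a
  proof -
    have "[d (P p) a = x a] (rmod (real 1))"
      by (rule rcong_dvd_modulus[OF P[OF a]]) simp
    then have "d (P p) a - x a \<in> \<int>" by (simp add: rcong_1_iff)
    then have "(d (P p) a - x a) - (d \<pi>0 a - x a) \<in> \<int>"
      using \<pi>0[OF a] by (rule Ints_diff)
    then obtain z where z: "d (P p) a - d \<pi>0 a = of_int z"
      by (auto elim: Ints_cases)
    then have "P p (head G a) - \<pi>0 (head G a) = (P p (tail G a) - \<pi>0 (tail G a)) + of_int z"
      by (simp add: d_def)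
    then have "\<rho> p (head G a) = \<rho> p (tail G a) + z" by (simp add: \<rho>_def)
    then show ?thesis using z by simp
  qed
  \<comment> \<open>The residues are glued at each node independently. This suffices because each
    arc period divides the event periods at both ends.\<close>
  have "\<exists>r. \<forall>i\<in>verts G. \<forall>p. prime p \<longrightarrow> int (p ^ multiplicity p (T i)) dvd r i - \<rho> p i"
    by (intro bchoice ballI chinese_remainder_prime_powers[OF assms(2)])
  then obtain r where r: "\<And>i p. i \<in> verts G \<Longrightarrow> prime p \<Longrightarrow>
      int (p ^ multiplicity p (T i)) dvd r i - \<rho> p i" by blast
  have "[d (\<lambda>i. \<pi>0 i + of_int (r i)) a = x a] (rmod (real (arc_period G T a)))"
    if a: "a \<in> arcs G" for a
  proof -
    let ?t = "tail G a" and ?h = "head G a" and ?n = "arc_period G T a"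
    obtain z where z: "d \<pi>0 a - x a = of_int z" using \<pi>0[OF a] by (auto elim: Ints_cases)
    have n: "?n > 0" using assms(2) a by (simp add: arc_period_def)
    \<comment> \<open>Modulo the \<open>p\<close>-part of the arc period, \<open>r\<close> agrees
      with \<open>\<rho> p\<close> at both ends, and \<open>\<pi>0 + \<rho> p\<close> has the same
      difference along \<open>a\<close> as \<open>P p\<close>.\<close>
    have dvd: "int (p ^ multiplicity p ?n) dvd r ?h - r ?t + z" if p: "prime p" for p
    proof -
      let ?q = "p ^ multiplicity p ?n"
      have "?q dvd p ^ multiplicity p (T i)" if "i \<in> {?t, ?h}" for i
        using that assms(2)[of i] a
        by (auto intro!: le_imp_power_dvd dvd_imp_multiplicity_le simp: arc_period_def)
      then have 1: "int ?q dvd r ?h - \<rho> p ?h" "int ?q dvd r ?t - \<rho> p ?t"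
        using r[of ?h p] r[of ?t p] a p by (meson dvd_trans of_nat_dvd_iff insertCI head_in_verts tail_in_verts)+
      have "[d (P p) a - x a = x a - x a] (rmod (real ?q))"
        using P[OF a] by (rule rcong_diff[OF _ rcong_refl])
      moreover have "d (P p) a - x a = of_int (\<rho> p ?h - \<rho> p ?t + z)"
        using \<rho>[OF a, of p] z by simp
      ultimately have 2: "int ?q dvd \<rho> p ?h - \<rho> p ?t + z"
        using rcong_of_int_iff[of "\<rho> p ?h - \<rho> p ?t + z" 0 ?q] by simp
      have "r ?h - r ?t + z = (r ?h - \<rho> p ?h) - (r ?t - \<rho> p ?t) + (\<rho> p ?h - \<rho> p ?t + z)"
        by simp
      then show ?thesis using 1 2 by (metis dvd_add dvd_diff)
    qed
    have "?n dvd nat \<bar>r ?h - r ?t + z\<bar>"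
    \<comment> \<open>Zero is treated apart because \<open>multiplicity p 0\<close> is 0 by
      convention.\<close>
    proof (cases "r ?h - r ?t + z = 0")
      case False
      have "multiplicity p ?n \<le> multiplicity p (nat \<bar>r ?h - r ?t + z\<bar>)" if p: "prime p" for p
        using dvd[OF p] False p by (intro multiplicity_geI) (auto simp: nat_abs_dvd_iff)
      then show ?thesis using n by (intro multiplicity_le_imp_dvd) auto
    qed simp
    then have "int ?n dvd r ?h - r ?t + z" by simp
    then have "[of_int (r ?h - r ?t + z) = of_int 0] (rmod (real ?n))"
      by (subst rcong_of_int_iff) simp
    moreover have "d (\<lambda>i. \<pi>0 i + of_int (r i)) a = of_int (r ?h - r ?t + z) + x a"
      using z by (simp add: d_def)
    ultimately show ?thesis
      using rcong_add_right_cancel[of "of_int (r ?h - r ?t + z)" "x a" 0] by simp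
  qed
  then show "\<exists>\<pi> :: 'a \<Rightarrow> real. \<forall>a\<in>arcs G.
       [\<pi> (head G a) - \<pi> (tail G a) = x a] (rmod (real (arc_period G T a)))"
    unfolding d_def by (intro exI ballI)
qed

end
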